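(* Let $K$ be a virtual knot. Then $J^2(K)=J(K)$, where $J^2(K)$ is the $2$-colour writhe of $K$ (a string of length one) and $J(K)$ is the odd writhe of $K$.
   Context: A virtual link diagram is a generic immersion of finitely many circles in the plane whose double points are marked either as classical crossings (with over/under information) or virtual crossings. A virtual link is an equivalence class of such diagrams under the virtual Reidemeister moves; $|L|$ denotes its number of components, and a virtual knot is a one-component virtual link. Classical crossings of an oriented diagram have a sign $\pm1$ in the usual way. Shadow: $S(D)$ is obtained from $D$ by forgetting the over/under decoration at classical crossings, which become flat crossings. The arcs of $S(D)$ run between flat crossings (passing straight through virtual crossings); a component without classical crossings is a single arc. A $2$-colouring $\mathscr{C}$ of $D$ is a colouring of the arcs of $S(D)$, each exactly one of red and green, such that on each of the two strands through a flat crossing the colour changes when passing straight through the crossing (so the four arc-ends are cyclically red, red, green, green). The global dual $\overline{\mathscr{C}}$ is obtained by interchanging red and green throughout. A diagram or link is $2$-colourable if it has a $2$-colouring (diagrams of virtual knots are always $2$-colourable). $2$-colour parity: for an oriented $D$ with $2$-colouring $\mathscr{C}$, a classical crossing $c$ has $\mathfrak{p}_{\mathscr{C}}(c)=0$ (even) if the two arcs oriented into $c$ have different colours, and $\mathfrak{p}_{\mathscr{C}}(c)=1$ (odd) if they have the same colour. A generating set of $2$-colourings of a diagram $D$ of $L$ is a set $\{\mathscr{C}_1,\ldots,\mathscr{C}_{2^{|L|-1}}\}$ consisting of one $2$-colouring from each pair $\{\mathscr{C},\overline{\mathscr{C}}\}$. Put $J_{\mathscr{C}}(D)=\sum_{\mathfrak{p}_{\mathscr{C}}(c)=1}\mathrm{sign}(c)$.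 The $2$-colour writhe is $J^2(L)=J^2(D)=(J_{\mathscr{C}_1}(D),\ldots,J_{\mathscr{C}_{2^{|L|-1}}}(D))\in\mathbb{Z}^{2^{|L|-1}}$, considered up to permutation of the entries; it does not depend on the generating set or on the diagram. Odd writhe: for a diagram $D$ of a virtual knot $K$, $J(K)$ is the sum of the signs of the classical crossings of $D$ that are odd with respect to the Gaussian parity: writing the classical crossings in the cyclic order met when traversing $D$ (each is met twice), a crossing $c$ is odd if an odd number of crossing occurrences lies between the two occurrences of $c$, and even otherwise. *)

theory Defs
  imports "HOL-Analysis.Analysis" "HOL-Library.Multiset" "HOL-Library.FuncSet"
begin

section \<open>Oriented virtual link diagrams\<close>

text \<open>
  The plane is the type \<^typ>\<open>complex\<close>. A diagram consists of \<open>num_comps\<close> many maps of the unit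
  circle to the plane, the set \<open>classical\<close> of those double points that are classical crossings
  (the other double points are the virtual crossings), and the set \<open>over\<close> of those points of
  the source circles that lie on the over-strand of a classical crossing. The components are
  oriented by the counterclockwise orientation of the circle.
\<close>

record vdiagram =
  num_comps :: nat
  curve :: "nat \<Rightarrow> complex \<Rightarrow> complex"
  classical :: "complex set"
  over :: "(nat \<times> complex) set"

abbreviation circle :: "complex set" where
  "circle \<equiv> sphere 0 1"

definition source :: "vdiagram \<Rightarrow> (nat \<times> complex) set" where
  "source D = {..<num_comps D} \<times> circle"

definition point :: "vdiagram \<Rightarrow> nat \<times> complex \<Rightarrow> complex" where
  "point D p = curve D (fst p) (snd p)"

definition velocity :: "vdiagram \<Rightarrow> nat \<times> complex \<Rightarrow> complex" where
  "velocity D p = vector_derivative (\<lambda>t. curve D (fst p) (snd p * cis t)) (at 0)"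

definition fibre :: "vdiagram \<Rightarrow> complex \<Rightarrow> (nat \<times> complex) set" where
  "fibre D x = {p \<in> source D. point D p = x}"

definition double_points :: "vdiagram \<Rightarrow> complex set" where
  "double_points D = {x. \<exists>p \<in> fibre D x. \<exists>q \<in> fibre D x. p \<noteq> q}"

text \<open>The determinant of the pair \<open>(v, w)\<close> of plane vectors.\<close>

definition cross :: "complex \<Rightarrow> complex \<Rightarrow> real" where
  "cross v w = Re v * Im w - Im v * Re w"

definition immersed :: "vdiagram \<Rightarrow> bool" where
  "immersed D \<longleftrightarrow>
     (\<forall>(i, z) \<in> source D. (\<lambda>t. curve D i (z * cis t)) differentiable at 0
                          \<and> velocity D (i, z) \<noteq> 0) \<and>
     (\<forall>i < num_comps D. continuous_on circle (\<lambda>z. velocity D (i, z)))"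

definition generic :: "vdiagram \<Rightarrow> bool" where
  "generic D \<longleftrightarrow>
     finite (double_points D) \<and>
     (\<forall>x \<in> double_points D. \<exists>p q. p \<noteq> q \<and> fibre D x = {p, q} \<and>
                             cross (velocity D p) (velocity D q) \<noteq> 0)"

definition virtual_link_diagram :: "vdiagram \<Rightarrow> bool" where
  "virtual_link_diagram D \<longleftrightarrow>
     num_comps D \<ge> 1 \<and> immersed D \<and> generic D \<and>
     classical D \<subseteq> double_points D \<and>
     over D \<subseteq> {p \<in> source D. point D p \<in> classical D} \<and>
     (\<forall>x \<in> classical D. \<exists>!p. p \<in> fibre D x \<and> p \<in> over D)"

definition over_point :: "vdiagram \<Rightarrow> complex \<Rightarrow> nat \<times> complex" where
  "over_point D c = (THE p. p \<in> fibre D c \<and> p \<in> over D)"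

definition under_point :: "vdiagram \<Rightarrow> complex \<Rightarrow> nat \<times> complex" where
  "under_point D c = (THE p. p \<in> fibre D c \<and> p \<notin> over D)"

text \<open>
  A crossing is positive if the over-direction followed by the under-direction is a positively
  oriented basis of the plane.
\<close>

definition crossing_sign :: "vdiagram \<Rightarrow> complex \<Rightarrow> int" where
  "crossing_sign D c =
     (if cross (velocity D (over_point D c)) (velocity D (under_point D c)) > 0 then 1 else - 1)"

section \<open>Virtual Reidemeister moves\<close>

text \<open>
  Planar isotopy: two diagrams are isotopic iff they differ by an orientation-preserving
  diffeomorphism of the plane and orientation-preserving reparametrisations of the circles. The
  permutation \<open>\<sigma>\<close> makes the numbering of the components irrelevant.
\<close>

definition plane_diffeo :: "(complex \<Rightarrow> complex) \<Rightarrow> bool" where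
  "plane_diffeo h \<longleftrightarrow> bij h \<and>
     (\<exists>h' :: complex \<Rightarrow> complex \<Rightarrow>\<^sub>L complex.
        continuous_on UNIV h' \<and>
        (\<forall>x. (h has_derivative blinfun_apply (h' x)) (at x)
             \<and> cross (blinfun_apply (h' x) 1) (blinfun_apply (h' x) \<i>) > 0))"

definition circle_diffeo :: "(complex \<Rightarrow> complex) \<Rightarrow> bool" where
  "circle_diffeo \<phi> \<longleftrightarrow>
     (\<exists>(\<psi> :: real \<Rightarrow> real) \<psi>'.
        (\<forall>t. \<phi> (cis t) = cis (\<psi> t)) \<and> (\<forall>t. \<psi> (t + 2 * pi) = \<psi> t + 2 * pi) \<and>
        continuous_on UNIV \<psi>' \<and>
        (\<forall>t. (\<psi> has_real_derivative \<psi>' t) (at t) \<and> \<psi>' t > 0))"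

definition isotopic :: "vdiagram \<Rightarrow> vdiagram \<Rightarrow> bool" where
  "isotopic D D' \<longleftrightarrow>
     num_comps D' = num_comps D \<and>
     (\<exists>h \<sigma> \<phi>. plane_diffeo h \<and> bij_betw \<sigma> {..<num_comps D} {..<num_comps D} \<and>
        (\<forall>i < num_comps D. circle_diffeo (\<phi> i)) \<and>
        (\<forall>(i, z) \<in> source D. curve D' i z = h (curve D (\<sigma> i) (\<phi> i z))) \<and>
        classical D' = h ` classical D \<and>
        over D' = {(i, z) \<in> source D. (\<sigma> i, \<phi> i z) \<in> over D})"

text \<open>
  The remaining moves replace the part of the diagram inside a disc. Up to isotopy the disc is the
  unit disc. A strand \<open>(i, a, b)\<close> is the closed arc of the \<open>i\<close>-th source circle between the angles
  \<open>a\<close> and \<open>b\<close>.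
\<close>

type_synonym strand = "nat \<times> real \<times> real"

definition strand_arc :: "strand \<Rightarrow> (nat \<times> complex) set" where
  "strand_arc = (\<lambda>(i, a, b). (\<lambda>t. (i, cis t)) ` {a..b})"

definition strand_interior :: "strand \<Rightarrow> (nat \<times> complex) set" where
  "strand_interior = (\<lambda>(i, a, b). (\<lambda>t. (i, cis t)) ` {a<..<b})"

text \<open>
  The part of \<open>D\<close> in the unit disc consists of the pairwise disjoint strands \<open>ss\<close>, which are
  properly embedded in their sources: only their end points lie on the boundary of the disc.
\<close>

definition tangle :: "vdiagram \<Rightarrow> strand list \<Rightarrow> bool" where
  "tangle D ss \<longleftrightarrow>
     (\<forall>(i, a, b) \<in> set ss. i < num_comps D \<and> a < b \<and> b < a + 2 * pi) \<and>
     (\<forall>j < length ss. \<forall>k < j. strand_arc (ss ! j) \<inter> strand_arc (ss ! k) = {}) \<and>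
     {p \<in> source D. point D p \<in> ball 0 1} = (\<Union>s \<in> set ss. strand_interior s) \<and>
     {p \<in> source D. point D p \<in> cball 0 1} = (\<Union>s \<in> set ss. strand_arc s) \<and>
     double_points D \<inter> sphere 0 1 = {}"

definition tangle_replacement :: "vdiagram \<Rightarrow> vdiagram \<Rightarrow> strand list \<Rightarrow> bool" where
  "tangle_replacement D D' ss \<longleftrightarrow>
     tangle D ss \<and> tangle D' ss \<and>
     num_comps D' = num_comps D \<and>
     (\<forall>p \<in> source D - (\<Union>s \<in> set ss. strand_interior s). point D' p = point D p) \<and>
     classical D' - ball 0 1 = classical D - ball 0 1 \<and>
     over D' - (\<Union>s \<in> set ss. strand_interior s) = over D - (\<Union>s \<in> set ss. strand_interior s)"

definition meets :: "vdiagram \<Rightarrow> strand \<Rightarrow> strand \<Rightarrow> complex set" where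
  "meets D s s' =
     {x. \<exists>p \<in> strand_arc s. \<exists>q \<in> strand_arc s'. p \<noteq> q \<and> point D p = x \<and> point D q = x}"

definition passes_over :: "vdiagram \<Rightarrow> strand \<Rightarrow> strand \<Rightarrow> bool" where
  "passes_over D s s' \<longleftrightarrow>
     (\<forall>x \<in> meets D s s'. x \<in> classical D \<and> (\<exists>p \<in> strand_arc s. point D p = x \<and> p \<in> over D))"

definition passes_virtually :: "vdiagram \<Rightarrow> strand \<Rightarrow> strand \<Rightarrow> bool" where
  "passes_virtually D s s' \<longleftrightarrow> meets D s s' \<inter> classical D = {}"

text \<open>
  An arc in a disc with exactly one transverse double point is a kink, so this is the first
  Reidemeister move in its classical and its virtual version, for all signs and directions.
\<close>

definition move1 :: "vdiagram \<Rightarrow> vdiagram \<Rightarrow> bool" where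
  "move1 D D' \<longleftrightarrow>
     (\<exists>s. tangle_replacement D D' [s] \<and> card (meets D s s) = 1 \<and> meets D' s s = {})"

text \<open>
  Two embedded arcs in a disc that cross exactly twice bound a bigon. Classical version: one arc is
  over at both crossings; virtual version: both crossings are virtual.
\<close>

definition move2 :: "vdiagram \<Rightarrow> vdiagram \<Rightarrow> bool" where
  "move2 D D' \<longleftrightarrow>
     (\<exists>s s'. tangle_replacement D D' [s, s'] \<and>
        (\<forall>E \<in> {D, D'}. meets E s s = {} \<and> meets E s' s' = {}) \<and>
        card (meets D s s') = 2 \<and> meets D' s s' = {} \<and>
        (passes_over D s s' \<or> passes_virtually D s s'))"

text \<open>
  Three embedded arcs in a disc, any two of which cross exactly once, with given end points: there
  are exactly two such configurations up to isotopy, the two sides of the third Reidemeister move.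
  (If \<open>D\<close> and \<open>D'\<close> show the same one, they are isotopic.) The three cases are the classical move,
  with \<open>s1\<close> on top and \<open>s3\<close> at the bottom; the mixed move, in which \<open>s1\<close> passes virtually across
  a classical crossing of \<open>s2\<close> and \<open>s3\<close>; and the purely virtual move. The moves with exactly two
  classical crossings are forbidden.
\<close>

definition move3 :: "vdiagram \<Rightarrow> vdiagram \<Rightarrow> bool" where
  "move3 D D' \<longleftrightarrow>
     (\<exists>s1 s2 s3. tangle_replacement D D' [s1, s2, s3] \<and>
        (\<forall>E \<in> {D, D'}. meets E s1 s1 = {} \<and> meets E s2 s2 = {} \<and> meets E s3 s3 = {} \<and>
           card (meets E s1 s2) = 1 \<and> card (meets E s1 s3) = 1 \<and> card (meets E s2 s3) = 1) \<and>
        ((\<forall>E \<in> {D, D'}. passes_over E s1 s2 \<and> passes_over E s1 s3 \<and> passes_over E s2 s3) \<or>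
         (\<forall>E \<in> {D, D'}. passes_virtually E s1 s2 \<and> passes_virtually E s1 s3 \<and>
            passes_over E s2 s3) \<or>
         (\<forall>E \<in> {D, D'}. passes_virtually E s1 s2 \<and> passes_virtually E s1 s3 \<and>
            passes_virtually E s2 s3)))"

definition virtual_move :: "vdiagram \<Rightarrow> vdiagram \<Rightarrow> bool" where
  "virtual_move D D' \<longleftrightarrow>
     virtual_link_diagram D \<and> virtual_link_diagram D' \<and>
     (isotopic D D' \<or> move1 D D' \<or> move2 D D' \<or> move3 D D')"

definition virtual_equivalence :: "(vdiagram \<times> vdiagram) set" where
  "virtual_equivalence =
     {(D, D'). virtual_link_diagram D \<and> virtual_link_diagram D' \<and> equivclp virtual_move D D'}"

definition virtual_links :: "vdiagram set set" where
  "virtual_links = {D. virtual_link_diagram D} // virtual_equivalence"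

text \<open>
  An invariant of diagrams is evaluated on a virtual link through a chosen diagram of it.
\<close>

definition diagram_of :: "vdiagram set \<Rightarrow> vdiagram" where
  "diagram_of L = (SOME D. D \<in> L)"

definition link_comps :: "vdiagram set \<Rightarrow> nat" where
  "link_comps L = num_comps (diagram_of L)"

definition virtual_knot :: "vdiagram set \<Rightarrow> bool" where
  "virtual_knot K \<longleftrightarrow> K \<in> virtual_links \<and> link_comps K = 1"

section \<open>2-colourings and the 2-colour writhe\<close>

definition flat_points :: "vdiagram \<Rightarrow> nat \<Rightarrow> complex set" where
  "flat_points D i = {z. (i, z) \<in> source D \<and> point D (i, z) \<in> classical D}"

text \<open>The arcs of the shadow, as connected subsets of the source circles.\<close>

definition arcs :: "vdiagram \<Rightarrow> (nat \<times> complex set) set" where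
  "arcs D = {(i, A). i < num_comps D \<and> A \<in> components (circle - flat_points D i)}"

definition arc_in :: "vdiagram \<Rightarrow> nat \<times> complex \<Rightarrow> nat \<times> complex set" where
  "arc_in D p = (THE (i, A). (i, A) \<in> arcs D \<and> i = fst p \<and>
                   (\<forall>\<^sub>F \<epsilon> in at_right 0. snd p * cis (- \<epsilon>) \<in> A))"

definition arc_out :: "vdiagram \<Rightarrow> nat \<times> complex \<Rightarrow> nat \<times> complex set" where
  "arc_out D p = (THE (i, A). (i, A) \<in> arcs D \<and> i = fst p \<and>
                    (\<forall>\<^sub>F \<epsilon> in at_right 0. snd p * cis \<epsilon> \<in> A))"

datatype colour = Red | Green

fun other_colour :: "colour \<Rightarrow> colour" where
  "other_colour Red = Green"
| "other_colour Green = Red"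

type_synonym colouring = "nat \<times> complex set \<Rightarrow> colour"

definition two_colourings :: "vdiagram \<Rightarrow> colouring set" where
  "two_colourings D =
     {\<C> \<in> arcs D \<rightarrow>\<^sub>E UNIV.
        \<forall>c \<in> classical D. \<forall>p \<in> fibre D c. \<C> (arc_in D p) \<noteq> \<C> (arc_out D p)}"

definition global_dual :: "vdiagram \<Rightarrow> colouring \<Rightarrow> colouring" where
  "global_dual D \<C> = restrict (\<lambda>a. other_colour (\<C> a)) (arcs D)"

definition colour_parity :: "vdiagram \<Rightarrow> colouring \<Rightarrow> complex \<Rightarrow> nat" where
  "colour_parity D \<C> c =
     (if \<forall>p \<in> fibre D c. \<forall>q \<in> fibre D c. p \<noteq> q \<longrightarrow> \<C> (arc_in D p) \<noteq> \<C> (arc_in D q)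
      then 0 else 1)"

definition colouring_writhe :: "vdiagram \<Rightarrow> colouring \<Rightarrow> int" where
  "colouring_writhe D \<C> = (\<Sum>c \<in> {c \<in> classical D. colour_parity D \<C> c = 1}. crossing_sign D c)"

definition generating_set :: "vdiagram \<Rightarrow> colouring set \<Rightarrow> bool" where
  "generating_set D \<G> \<longleftrightarrow>
     two_colourings D \<noteq> {} \<and> \<G> \<subseteq> two_colourings D \<and>
     (\<forall>\<C> \<in> two_colourings D. (\<C> \<in> \<G>) \<noteq> (global_dual D \<C> \<in> \<G>))"

text \<open>Tuples up to permutation of the entries are multisets.\<close>

definition generated_writhe :: "vdiagram \<Rightarrow> colouring set \<Rightarrow> int multiset" where
  "generated_writhe D \<G> = image_mset (colouring_writhe D) (mset_set \<G>)"

definition diagram_two_colour_writhe :: "vdiagram \<Rightarrow> int multiset" where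
  "diagram_two_colour_writhe D = generated_writhe D (SOME \<G>. generating_set D \<G>)"

definition two_colour_writhe :: "vdiagram set \<Rightarrow> int multiset" where
  "two_colour_writhe L = diagram_two_colour_writhe (diagram_of L)"

section \<open>Gaussian parity and the odd writhe\<close>

text \<open>
  The crossing occurrences met strictly between \<open>z\<close> and \<open>w\<close> when a one-component diagram is
  traversed from \<open>z\<close> to \<open>w\<close> along its orientation.
\<close>

definition occurrences_between :: "vdiagram \<Rightarrow> complex \<Rightarrow> complex \<Rightarrow> complex set" where
  "occurrences_between D z w =
     {u \<in> flat_points D 0. \<exists>s t. 0 < s \<and> s < t \<and> t < 2 * pi \<and> u = z * cis s \<and> w = z * cis t}"

text \<open>
  The order of the two occurrences \<open>z\<close> and \<open>w\<close> does not matter, since the total number of the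
  other occurrences is even.
\<close>

definition gauss_odd :: "vdiagram \<Rightarrow> complex \<Rightarrow> bool" where
  "gauss_odd D c \<longleftrightarrow>
     (\<exists>z w. z \<noteq> w \<and> fibre D c = {(0, z), (0, w)} \<and> odd (card (occurrences_between D z w)))"

definition diagram_odd_writhe :: "vdiagram \<Rightarrow> int" where
  "diagram_odd_writhe D = (\<Sum>c \<in> {c \<in> classical D. gauss_odd D c}. crossing_sign D c)"

definition odd_writhe :: "vdiagram set \<Rightarrow> int" where
  "odd_writhe K = diagram_odd_writhe (diagram_of K)"

end

theory Submission
  imports Defs
begin

text \<open>
  Let \<open>F\<close> be the set of crossing occurrences on the source circle of a knot diagram. It has even
  cardinality, so for arguments \<open>\<theta> v\<close> of the \<open>v \<in> F\<close> the product of the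
  \<open>sin ((t - \<theta> v) / 2)\<close> is a continuous function of \<open>cis t\<close>, and it changes its sign exactly
  at the points of \<open>F\<close>: its sign is a 2-colouring. The set where two 2-colourings agree is open and
  closed in the circle, hence the sign colouring and its dual are the only ones. For a crossing with
  occurrences \<open>z = cis a\<close> and \<open>w = cis b\<close>, \<open>a < b < a + 2 * pi\<close>, take \<open>\<theta>\<close> with values in
  \<open>[a, a + 2 * pi)\<close>. Just before \<open>a\<close> all factors are negative, and just before \<open>b\<close> those with
  \<open>\<theta> v \<in> [a, b)\<close> have become positive. So the two incoming arcs have the same colour iff the number of
  occurrences strictly between \<open>z\<close> and \<open>w\<close> is odd.
\<close>

section \<open>Complements of finite sets in the circle\<close>

lemma cis_eq_imp_eq:
  assumes "cis s = cis t" "\<bar>s - t\<bar> < 2 * pi"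
  shows "s = t"
proof -
  have "sin s = sin t \<and> cos s = cos t"
    using assms(1) by (simp add: complex_eq_iff)
  then obtain n where n: "s = t + 2 * pi * of_int n"
    using sin_cos_eq_iff by metis
  with assms(2) have "\<bar>of_int n :: real\<bar> < 1"
    by (simp add: abs_mult)
  then have "n = 0" by linarith
  with n show ?thesis by simp
qed

lemma circle_imp_cis:
  assumes "u \<in> circle"
  obtains t where "u = cis t"
  using assms by (metis complex_norm_eq_1_exp cis_conv_exp mem_sphere_0)

text \<open>If \<open>cis t\<close> is \<open>v\<close> itself, injectivity of \<open>cis\<close> on
  intervals shorter than a full turn keeps nearby angles off \<open>v\<close>; otherwise continuity
  does.\<close>

lemma eventually_cis_neq: "\<forall>\<^sub>F s in at t. cis s \<noteq> v"
proof (cases "v = cis t")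
  case True
  have "\<forall>\<^sub>F s in at t. dist s t < 2 * pi \<and> s \<noteq> t"
    unfolding eventually_at by (rule exI[of _ "2 * pi"]) simp
  then show ?thesis
    by eventually_elim (use True cis_eq_imp_eq in \<open>auto simp: dist_real_def\<close>)
next
  case False
  have "(cis \<longlongrightarrow> cis t) (at t)"
    using continuous_on_cis[OF continuous_on_id[of UNIV]]
    by (simp add: continuous_on_eq_continuous_at isCont_def)
  then show ?thesis
    using False by (intro tendsto_imp_eventually_ne) auto
qed

lemma eventually_cis_notin:
  assumes "finite F"
  shows "\<forall>\<^sub>F s in at t. cis s \<notin> F"
proof -
  have "\<forall>\<^sub>F s in at t. \<forall>v\<in>F. cis s \<noteq> v"
    using assms eventually_cis_neq by (intro eventually_ball_finite) auto
  then show ?thesis by eventually_elim auto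
qed

lemma connected_cis_image: "connected S \<Longrightarrow> connected (cis ` S)"
  by (intro connected_continuous_image continuous_intros)

text \<open>A short interval of angles ending at \<open>t\<close> avoids \<open>F\<close>, and its
  connected image lies in one component. This also covers \<open>cis t \<in> F\<close>, where an arc
  ends.\<close>

lemma component_at_left:
  assumes "finite F"
  obtains A where "A \<in> components (circle - F)" "\<forall>\<^sub>F s in at_left t. cis s \<in> A"
proof -
  have "\<forall>\<^sub>F s in at_left t. cis s \<notin> F"
    using eventually_cis_notin[OF assms, of t] by (simp add: eventually_at_split)
  then obtain b where b: "b < t" "\<And>s. b < s \<Longrightarrow> s < t \<Longrightarrow> cis s \<notin> F"
    by (auto simp: eventually_at_left_field)
  let ?I = "cis ` {b<..<t}"
  have "?I \<subseteq> circle - F" "?I \<noteq> {}" "connected ?I"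
    using b by (auto intro: connected_cis_image)
  then obtain A where "A \<in> components (circle - F)" "?I \<subseteq> A"
    by (metis exists_component_superset subset_empty)
  with b(1) show ?thesis by (intro that[of A]) (auto simp: eventually_at_left_field intro!: exI[of _ b])
qed

lemma component_at_right:
  assumes "finite F"
  obtains A where "A \<in> components (circle - F)" "\<forall>\<^sub>F s in at_right t. cis s \<in> A"
proof -
  have "\<forall>\<^sub>F s in at_right t. cis s \<notin> F"
    using eventually_cis_notin[OF assms, of t] by (simp add: eventually_at_split)
  then obtain b where b: "t < b" "\<And>s. t < s \<Longrightarrow> s < b \<Longrightarrow> cis s \<notin> F"
    by (auto simp: eventually_at_right_field)
  let ?I = "cis ` {t<..<b}"
  have "?I \<subseteq> circle - F" "?I \<noteq> {}" "connected ?I"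
    using b by (auto intro: connected_cis_image)
  then obtain A where "A \<in> components (circle - F)" "?I \<subseteq> A"
    by (metis exists_component_superset subset_empty)
  with b(1) show ?thesis by (intro that[of A]) (auto simp: eventually_at_right_field intro!: exI[of _ b])
qed

text \<open>Components of the complement of a finite set are open in the circle, here stated in
  terms of angles.\<close>

lemma eventually_in_component:
  assumes "finite F" "A \<in> components (circle - F)" "cis t \<in> A"
  shows "\<forall>\<^sub>F s in at t. cis s \<in> A"
proof -
  have "cis t \<notin> F" using assms in_components_subset by blast
  obtain d where d: "d > 0" "\<And>s. s \<noteq> t \<Longrightarrow> dist s t < d \<Longrightarrow> cis s \<notin> F"
    using eventually_cis_notin[OF assms(1), of t] by (auto simp: eventually_at)
  have "cis ` ball t d \<subseteq> circle - F"
    using d \<open>cis t \<notin> F\<close> by (force simp: dist_commute)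
  moreover have "A \<inter> cis ` ball t d \<noteq> {}"
    using d(1) assms(3) by (metis centre_in_ball disjoint_iff imageI)
  moreover have "connected (cis ` ball t d)"
    by (intro connected_cis_image) simp
  ultimately have "cis ` ball t d \<subseteq> A"
    using components_maximal[OF assms(2)] by blast
  then show ?thesis
    unfolding eventually_at using d(1) by (auto simp: dist_commute intro!: exI[of _ d])
qed

text \<open>Supplies the uniqueness needed by the definite descriptions in \<open>arc_in\<close> and
  \<open>arc_out\<close>.\<close>

lemma component_unique:
  assumes "A \<in> components S" "B \<in> components S" "\<forall>\<^sub>F s in F. f s \<in> A" "\<forall>\<^sub>F s in F. f s \<in> B"
    "F \<noteq> bot"
  shows "A = B"
proof -
  have "\<forall>\<^sub>F s in F. f s \<in> A \<and> f s \<in> B"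
    using assms by (simp add: eventually_conj)
  then have "\<exists>s. f s \<in> A \<and> f s \<in> B"
    using assms(5) by (rule eventually_happens'[rotated])
  with assms(1,2) show ?thesis
    using components_nonoverlap by blast
qed

lemma eventually_at_left_nested:
  fixes t :: real
  assumes "eventually P (at_left t)"
  shows "\<forall>\<^sub>F s in at_left t. eventually P (at_left s)"
proof -
  obtain b where b: "b < t" "\<And>s. b < s \<Longrightarrow> s < t \<Longrightarrow> P s"
    using assms by (auto simp: eventually_at_left_field)
  then have "eventually P (at_left s)" if "b < s" "s < t" for s
    using that unfolding eventually_at_left_field by (meson less_trans)
  with b(1) show ?thesis
    unfolding eventually_at_left_field[of _ t] by blast
qed

text \<open>The inner filter is \<open>at_left\<close>: this serves to identify the incoming arcs of
  points just after \<open>t\<close> with the outgoing arc at \<open>t\<close>.\<close>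

lemma eventually_at_right_nested:
  fixes t :: real
  assumes "eventually P (at_right t)"
  shows "\<forall>\<^sub>F s in at_right t. eventually P (at_left s)"
proof -
  obtain b where b: "t < b" "\<And>s. t < s \<Longrightarrow> s < b \<Longrightarrow> P s"
    using assms by (auto simp: eventually_at_right_field)
  then have "eventually P (at_left s)" if "t < s" "s < b" for s
    using that unfolding eventually_at_left_field by (meson less_trans)
  with b(1) show ?thesis
    unfolding eventually_at_right_field by blast
qed

section \<open>The sign function\<close>

text \<open>Each factor has simple zeros exactly at the angles of \<open>cis (\<theta> v)\<close>
  and changes sign under a full turn, so an even number of factors gives a function of period
  \<open>2 * pi\<close>.\<close>

definition sign_fun :: "complex set \<Rightarrow> (complex \<Rightarrow> real) \<Rightarrow> real \<Rightarrow> real" where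
  "sign_fun F \<theta> t = (\<Prod>v\<in>F. sin ((t - \<theta> v) / 2))"

text \<open>The chord formula: up to nonvanishing factors, the sine of the half-angle is the
  difference of two points of the circle.\<close>

lemma cis_diff: "cis t - cis r = cis (t / 2) * (2 * \<i> * cis (r / 2)) * of_real (sin ((t - r) / 2))"
proof -
  define x y where "x = t / 2" and "y = r / 2"
  have 1: "t = 2 * x" "r = 2 * y" "(t - r) / 2 = x - y"
    by (simp_all add: x_def y_def field_simps)
  have 2: "\<i> * (2 * of_real (sin (x - y))) = cis (x - y) - cis (y - x)"
    by (simp add: complex_eq_iff cos_diff sin_diff algebra_simps)
  have "cis x * (2 * \<i> * cis y) * of_real (sin (x - y)) = cis (x + y) * (cis (x - y) - cis (y - x))"
    unfolding 2[symmetric] cis_mult[symmetric] by (simp add: algebra_simps)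
  also have "\<dots> = cis (2 * x) - cis (2 * y)"
    by (simp add: right_diff_distrib cis_mult)
  finally show ?thesis unfolding 1(1,2) 1(3)[unfolded 1(1,2)] by simp
qed

text \<open>Multiplying the chord formula over \<open>F\<close> leaves the power
  \<open>cis (t / 2) ^ card F\<close>. For even \<open>card F\<close> it is a power of
  \<open>cis t\<close>, so dividing by it is single-valued on the circle.\<close>

lemma sign_fun_descends:
  assumes "even (card F)" "\<And>v. v \<in> F \<Longrightarrow> cis (\<theta> v) = v"
  obtains g :: "complex \<Rightarrow> real" where "continuous_on circle g" "\<And>t. g (cis t) = sign_fun F \<theta> t"
proof -
  obtain m where m: "card F = 2 * m" using assms(1) by (elim evenE)
  define c where "c = (\<Prod>v\<in>F. 2 * \<i> * cis (\<theta> v / 2))"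
  \<comment> \<open>On the circle the quotient is already real; \<open>Re\<close> only adjusts the
    type.\<close>
  define g where "g u = Re ((\<Prod>v\<in>F. u - v) / (u ^ m * c))" for u
  \<comment> \<open>For infinite \<open>F\<close> the product has the default value 1.\<close>
  have "c \<noteq> 0"
    by (cases "finite F") (auto simp: c_def)
  have "continuous_on circle g"
    unfolding g_def using \<open>c \<noteq> 0\<close> by (intro continuous_intros) auto
  moreover have "g (cis t) = sign_fun F \<theta> t" for t
  proof -
    have "(\<Prod>v\<in>F. cis t - v) =
        (\<Prod>v\<in>F. cis (t / 2) * (2 * \<i> * cis (\<theta> v / 2)) * of_real (sin ((t - \<theta> v) / 2)))"
      using assms(2) cis_diff[of t] by (intro prod.cong) (auto, metis)
    also have "\<dots> = cis (t / 2) ^ card F * c * of_real (sign_fun F \<theta> t)"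
      unfolding c_def sign_fun_def prod.distrib by simp
    also have "cis (t / 2) ^ card F = cis t ^ m"
      unfolding m power_mult by (simp add: power2_eq_square cis_mult)
    finally show ?thesis
      using \<open>c \<noteq> 0\<close> by (simp add: g_def)
  qed
  ultimately show ?thesis by (rule that)
qed

lemma sin_half_eq_0_iff: "sin ((t - r) / 2) = 0 \<longleftrightarrow> cis t = cis r"
  by (metis cis_diff cis_neq_zero complex_i_not_zero eq_iff_diff_eq_0 mult_eq_0_iff
      of_real_eq_0_iff zero_neq_numeral)

lemma sign_fun_eq_0_iff:
  assumes "finite F" "\<And>v. v \<in> F \<Longrightarrow> cis (\<theta> v) = v"
  shows "sign_fun F \<theta> t = 0 \<longleftrightarrow> cis t \<in> F"
  using assms by (auto simp: sign_fun_def sin_half_eq_0_iff)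

text \<open>At \<open>t\<close> only the factor of \<open>cis t\<close> vanishes, and it changes
  sign; the product of the others keeps its sign nearby.\<close>

lemma sign_fun_changes:
  assumes "finite F" "\<And>v. v \<in> F \<Longrightarrow> cis (\<theta> v) = v" "cis t \<in> F"
  shows "\<forall>\<^sub>F e in at_right 0. sign_fun F \<theta> (t - e) * sign_fun F \<theta> (t + e) < 0"
proof -
  define F' where "F' = F - {cis t}"
  define k where "k e = sign_fun F' \<theta> (t - e) * sign_fun F' \<theta> (t + e)" for e
  have F': "finite F'" "\<And>v. v \<in> F' \<Longrightarrow> cis (\<theta> v) = v" "cis t \<notin> F'"
    using assms by (auto simp: F'_def)
  have "isCont k 0"
    unfolding k_def sign_fun_def by (intro continuous_intros) auto
  \<comment> \<open>\<open>k 0\<close> is the square of a nonzero number.\<close>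
  moreover have "k 0 > 0"
    using sign_fun_eq_0_iff[OF F'(1,2), of t] F'(3)
    by (simp add: k_def zero_less_mult_iff) linarith
  ultimately have "\<forall>\<^sub>F e in at 0. k e > 0"
    unfolding isCont_def by (rule order_tendstoD)
  then have 1: "\<forall>\<^sub>F e in at_right 0. k e > 0"
    by (simp add: eventually_at_split)
  have 2: "\<forall>\<^sub>F e in at_right 0. 0 < e \<and> e < 2 * pi"
    using eventually_at_right_real[of 0 "2 * pi"] by simp
  have split: "sign_fun F \<theta> s = sin ((s - \<theta> (cis t)) / 2) * sign_fun F' \<theta> s" for s
    unfolding sign_fun_def F'_def using assms by (simp add: prod.remove)
  \<comment> \<open>The angles \<open>t\<close> and \<open>\<theta> (cis t)\<close> may differ by
    full turns. So the half-difference \<open>x\<close> only satisfies \<open>sin x = 0\<close>,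
    which suffices because just \<open>(cos x)\<^sup>2 = 1\<close> enters.\<close>
  have *: "sin ((t - e - \<theta> (cis t)) / 2) * sin ((t + e - \<theta> (cis t)) / 2) = - (sin (e / 2))\<^sup>2" for e
  proof -
    define x y where "x = (t - \<theta> (cis t)) / 2" and "y = e / 2"
    have "sin x = 0"
      unfolding x_def sin_half_eq_0_iff using assms by simp
    have "sin (x - y) * sin (x + y) = - (sin y)\<^sup>2 * (cos x)\<^sup>2"
      by (simp add: sin_add sin_diff \<open>sin x = 0\<close> power2_eq_square)
    also have "(cos x)\<^sup>2 = 1"
      using \<open>sin x = 0\<close> by (simp add: cos_squared_eq)
    finally show ?thesis
      by (simp add: x_def y_def add_divide_distrib diff_divide_distrib algebra_simps)
  qed
  from 1 2 show ?thesis
  proof eventually_elim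
    case (elim e)
    have "sign_fun F \<theta> (t - e) * sign_fun F \<theta> (t + e) = - ((sin (e / 2))\<^sup>2 * k e)"
      unfolding split k_def using *[of e] by (simp add: algebra_simps)
    moreover have "sin (e / 2) > 0"
      using elim by (intro sin_gt_zero) auto
    ultimately show ?case using elim by simp
  qed
qed

text \<open>All half-angles lie strictly between \<open>- pi\<close> and \<open>pi\<close>, where
  the sine has the sign of its argument.\<close>

lemma sign_fun_sgn:
  assumes "finite F" "\<And>v. v \<in> F \<Longrightarrow> \<bar>t - \<theta> v\<bar> < 2 * pi" "\<And>v. v \<in> F \<Longrightarrow> t \<noteq> \<theta> v"
  shows "sgn (sign_fun F \<theta> t) = (-1) ^ card {v \<in> F. t < \<theta> v}"
proof -
  have "sgn (sign_fun F \<theta> t) = (\<Prod>v\<in>F. sgn (sin ((t - \<theta> v) / 2)))"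
    unfolding sign_fun_def by (induction F rule: infinite_finite_induct) (auto simp: sgn_mult)
  also have "\<dots> = (\<Prod>v\<in>F. if t < \<theta> v then -1 else 1)"
  proof (rule prod.cong[OF refl])
    fix v assume v: "v \<in> F"
    show "sgn (sin ((t - \<theta> v) / 2)) = (if t < \<theta> v then -1 else 1)"
    proof (cases "t < \<theta> v")
      case True
      then have "sin ((\<theta> v - t) / 2) > 0"
        using assms(2)[OF v] by (intro sin_gt_zero) auto
      moreover have "sin ((t - \<theta> v) / 2) = - sin ((\<theta> v - t) / 2)"
        by (simp add: minus_divide_left flip: sin_minus)
      ultimately show ?thesis using True by simp
    next
      case False
      then have "sin ((t - \<theta> v) / 2) > 0"
        using assms(2,3)[OF v] by (intro sin_gt_zero) auto
      then show ?thesis using False by simp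
    qed
  qed
  also have "\<dots> = (-1) ^ card {v \<in> F. t < \<theta> v}"
    using assms(1) by (simp add: prod.If_cases Int_def)
  finally show ?thesis .
qed

section \<open>Arcs of a knot diagram\<close>

lemma other_colour_neq [simp]: "other_colour a \<noteq> a" "a \<noteq> other_colour a"
  by (cases a; simp)+

lemma other_colour_involutive [simp]: "other_colour (other_colour a) = a"
  by (cases a) auto

lemma colour_neq_iff: "a \<noteq> b \<longleftrightarrow> a = other_colour b"
  by (cases a; cases b) auto

locale knot_diagram =
  fixes D :: vdiagram
  assumes diagram: "virtual_link_diagram D" and one_comp: "num_comps D = 1"
begin

abbreviation occs :: "complex set" where
  "occs \<equiv> flat_points D 0"

lemma classical_subset: "classical D \<subseteq> double_points D"
  using diagram by (simp add: virtual_link_diagram_def)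

lemma finite_classical: "finite (classical D)"
  using diagram classical_subset finite_subset
  by (auto simp: virtual_link_diagram_def generic_def)

lemma fibre_classical:
  assumes "c \<in> classical D"
  obtains z w where "z \<noteq> w" "fibre D c = {(0, z), (0, w)}"
proof -
  have "c \<in> double_points D"
    using assms classical_subset by blast
  then obtain p q where pq: "p \<noteq> q" "fibre D c = {p, q}"
    using diagram unfolding virtual_link_diagram_def generic_def by meson
  have "fst r = 0" if "r \<in> fibre D c" for r
    using that one_comp by (auto simp: fibre_def source_def)
  then have "p = (0, snd p)" "q = (0, snd q)"
    using pq by (auto simp: prod_eq_iff)
  with pq show ?thesis by (metis that)
qed

lemma fibre_imp_occs: "c \<in> classical D \<Longrightarrow> (0, z) \<in> fibre D c \<Longrightarrow> z \<in> occs"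
  by (auto simp: flat_points_def fibre_def)

lemma occs_eq: "occs = (\<Union>c\<in>classical D. snd ` fibre D c)"
  using one_comp by (force simp: flat_points_def fibre_def source_def image_iff)

lemma finite_occs: "finite occs"
proof -
  have "finite (fibre D c)" if "c \<in> classical D" for c
    using fibre_classical[OF that] by (metis finite.emptyI finite_insert)
  then show ?thesis
    unfolding occs_eq using finite_classical by blast
qed

lemma occs_subset: "occs \<subseteq> circle"
  by (auto simp: flat_points_def source_def)

text \<open>The occurrences are partitioned into the two-point fibres of the crossings. This is the
  parity that \<open>sign_fun_descends\<close> requires.\<close>

lemma even_card_occs: "even (card occs)"
proof -
  have 2: "card (snd ` fibre D c) = 2" if "c \<in> classical D" for c
    using fibre_classical[OF that] by (metis card_2_iff image_empty image_insert snd_conv)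
  have "card occs = (\<Sum>c\<in>classical D. card (snd ` fibre D c))"
    unfolding occs_eq
  proof (rule card_UN_disjoint)
    show "\<forall>c\<in>classical D. finite (snd ` fibre D c)"
      using 2 by (simp add: card_ge_0_finite)
    show "\<forall>c\<in>classical D. \<forall>c'\<in>classical D. c \<noteq> c' \<longrightarrow> snd ` fibre D c \<inter> snd ` fibre D c' = {}"
      using one_comp by (auto simp: fibre_def source_def)
  qed (fact finite_classical)
  also have "\<dots> = 2 * card (classical D)"
    using 2 by simp
  finally show ?thesis by simp
qed

lemma arcs_eq: "arcs D = {0} \<times> components (circle - occs)"
  using one_comp by (auto simp: arcs_def)

text \<open>Evaluates the definite description, so that later arguments need only components and
  one-sided limits of angles.\<close>

lemma arc_in_eq:
  assumes A: "A \<in> components (circle - occs)" "\<forall>\<^sub>F s in at_left t. cis s \<in> A"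
  shows "arc_in D (0, cis t) = (0, A)"
proof -
  \<comment> \<open>The substitution \<open>s = t - e\<close>, carried out through the reflection of
    \<open>at_left t\<close> to \<open>at_right (- t)\<close>.\<close>
  have shift: "(\<forall>\<^sub>F e in at_right 0. cis t * cis (- e) \<in> B) \<longleftrightarrow> (\<forall>\<^sub>F s in at_left t. cis s \<in> B)" for B
    by (simp add: cis_mult eventually_at_right_to_0[of _ "-t"] at_left_minus[of t]
        eventually_filtermap)
  have "(case p of (i, B) \<Rightarrow> (i, B) \<in> arcs D \<and> i = fst (0, cis t) \<and>
      (\<forall>\<^sub>F e in at_right 0. snd (0, cis t) * cis (- e) \<in> B)) \<longleftrightarrow> p = (0, A)" for p :: "nat \<times> _"
  proof (cases p)
    case (Pair i B)
    then show ?thesis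
      using A component_unique[OF A(1) _ A(2), of B] by (simp add: arcs_eq shift) blast
  qed
  then show ?thesis
    unfolding arc_in_def by (intro the_equality) simp_all
qed

lemma arc_out_eq:
  assumes A: "A \<in> components (circle - occs)" "\<forall>\<^sub>F s in at_right t. cis s \<in> A"
  shows "arc_out D (0, cis t) = (0, A)"
proof -
  have shift: "(\<forall>\<^sub>F e in at_right 0. cis t * cis e \<in> B) \<longleftrightarrow> (\<forall>\<^sub>F s in at_right t. cis s \<in> B)" for B
    by (simp add: cis_mult eventually_at_right_to_0[of _ t] add.commute)
  have "(case p of (i, B) \<Rightarrow> (i, B) \<in> arcs D \<and> i = fst (0, cis t) \<and>
      (\<forall>\<^sub>F e in at_right 0. snd (0, cis t) * cis e \<in> B)) \<longleftrightarrow> p = (0, A)" for p :: "nat \<times> _"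
  proof (cases p)
    case (Pair i B)
    then show ?thesis
      using A component_unique[OF A(1) _ A(2), of B] by (simp add: arcs_eq shift) blast
  qed
  then show ?thesis
    unfolding arc_out_def by (intro the_equality) simp_all
qed

lemma arc_in_out_eq:
  assumes "A \<in> components (circle - occs)" "cis t \<in> A"
  shows "arc_in D (0, cis t) = (0, A)" "arc_out D (0, cis t) = (0, A)"
  using eventually_in_component[OF finite_occs assms] assms(1)
  by (auto simp: eventually_at_split intro: arc_in_eq arc_out_eq)

lemma arc_in_obtain:
  obtains A where "A \<in> components (circle - occs)" "\<forall>\<^sub>F s in at_left t. cis s \<in> A"
    "arc_in D (0, cis t) = (0, A)"
  using component_at_left[OF finite_occs, of t] arc_in_eq by metis

lemma arc_out_obtain:
  obtains A where "A \<in> components (circle - occs)" "\<forall>\<^sub>F s in at_right t. cis s \<in> A"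
    "arc_out D (0, cis t) = (0, A)"
  using component_at_right[OF finite_occs, of t] arc_out_eq by metis

lemma arc_in_eq_arc_out:
  assumes "cis t \<notin> occs"
  shows "arc_in D (0, cis t) = arc_out D (0, cis t)"
proof -
  have "cis t \<in> \<Union> (components (circle - occs))"
    using assms by (simp add: Union_components)
  then show ?thesis
    using arc_in_out_eq by (metis UnionE)
qed

text \<open>Every arc is the incoming arc of each of its own points, so a colouring can be studied
  as a function of the angle.\<close>

lemma arcs_imp_arc_in:
  assumes "a \<in> arcs D"
  obtains t where "a = arc_in D (0, cis t)"
proof -
  obtain A where A: "A \<in> components (circle - occs)" "a = (0, A)"
    using assms by (auto simp: arcs_eq)
  then obtain u where "u \<in> A" "u \<in> circle"
    using in_components_nonempty in_components_subset by blast
  moreover from \<open>u \<in> circle\<close> obtain t where "u = cis t"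
    by (rule circle_imp_cis)
  ultimately show ?thesis
    using A arc_in_out_eq that by metis
qed

lemma arc_in_arcs: "arc_in D (0, cis t) \<in> arcs D"
  by (rule arc_in_obtain[of t]) (simp add: arcs_eq)

lemma arc_out_arcs: "arc_out D (0, cis t) \<in> arcs D"
  by (rule arc_out_obtain[of t]) (simp add: arcs_eq)

lemma eventually_arc_in_at_left: "\<forall>\<^sub>F s in at_left t. arc_in D (0, cis s) = arc_in D (0, cis t)"
proof -
  obtain A where A: "A \<in> components (circle - occs)" "\<forall>\<^sub>F s in at_left t. cis s \<in> A"
    "arc_in D (0, cis t) = (0, A)" by (rule arc_in_obtain)
  from eventually_at_left_nested[OF A(2)] show ?thesis
    by eventually_elim (use A arc_in_eq in simp)
qed

text \<open>Just after \<open>t\<close> the incoming arc is the one that leaves \<open>t\<close>; as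
  a function of the angle, \<open>arc_in\<close> can therefore jump only at occurrences.\<close>

lemma eventually_arc_in_at_right: "\<forall>\<^sub>F s in at_right t. arc_in D (0, cis s) = arc_out D (0, cis t)"
proof -
  obtain A where A: "A \<in> components (circle - occs)" "\<forall>\<^sub>F s in at_right t. cis s \<in> A"
    "arc_out D (0, cis t) = (0, A)" by (rule arc_out_obtain)
  from eventually_at_right_nested[OF A(2)] show ?thesis
    by eventually_elim (use A arc_in_eq in simp)
qed

section \<open>The 2-colourings of a knot diagram\<close>

lemma two_colouringsI:
  assumes "\<C> \<in> extensional (arcs D)"
    "\<And>t. cis t \<in> occs \<Longrightarrow> \<C> (arc_in D (0, cis t)) \<noteq> \<C> (arc_out D (0, cis t))"
  shows "\<C> \<in> two_colourings D"
proof -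
  have "\<C> (arc_in D p) \<noteq> \<C> (arc_out D p)" if cp: "c \<in> classical D" "p \<in> fibre D c" for c p
  proof -
    obtain z where p: "p = (0, z)"
      using fibre_classical[OF cp(1)] cp(2) by auto
    then have z: "z \<in> occs"
      using cp fibre_imp_occs by blast
    then obtain t where "z = cis t"
      using occs_subset by (metis circle_imp_cis subsetD)
    with p z assms(2) show ?thesis by simp
  qed
  with assms(1) show ?thesis
    by (auto simp: two_colourings_def PiE_def)
qed

lemma two_colouringsD:
  assumes "\<C> \<in> two_colourings D" "cis t \<in> occs"
  shows "\<C> (arc_in D (0, cis t)) \<noteq> \<C> (arc_out D (0, cis t))"
proof -
  have "point D (0, cis t) \<in> classical D" "(0, cis t) \<in> fibre D (point D (0, cis t))"
    using assms(2) by (auto simp: flat_points_def fibre_def)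
  with assms(1) show ?thesis
    by (auto simp: two_colourings_def)
qed

lemma two_colourings_extensional: "\<C> \<in> two_colourings D \<Longrightarrow> \<C> \<in> extensional (arcs D)"
  by (auto simp: two_colourings_def PiE_def)

lemma global_dual_apply: "a \<in> arcs D \<Longrightarrow> global_dual D \<C> a = other_colour (\<C> a)"
  by (simp add: global_dual_def)

lemma global_dual_in: "\<C> \<in> two_colourings D \<Longrightarrow> global_dual D \<C> \<in> two_colourings D"
  using two_colouringsD[of \<C>]
  by (intro two_colouringsI)
    (auto simp: global_dual_apply arc_in_arcs arc_out_arcs colour_neq_iff global_dual_def)

text \<open>There is always at least one arc, for instance the incoming arc at angle 0, and its
  colour changes.\<close>

lemma global_dual_neq: "global_dual D \<C> \<noteq> \<C>"
  using global_dual_apply[OF arc_in_arcs, of \<C> 0] other_colour_neq by metis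

lemma global_dual_global_dual:
  "\<C> \<in> two_colourings D \<Longrightarrow> global_dual D (global_dual D \<C>) = \<C>"
  using two_colourings_extensional[of \<C>]
  by (intro ext) (auto simp: global_dual_def restrict_def extensional_def)

text \<open>At an occurrence both colourings switch, so agreement before it is equivalent to
  agreement after it. Agreement is thus locally constant on the real line of angles, hence
  constant.\<close>

lemma two_colourings_unique:
  assumes C: "\<C> \<in> two_colourings D" "\<C>' \<in> two_colourings D"
  shows "\<C>' = \<C> \<or> \<C>' = global_dual D \<C>"
proof -
  define agree where "agree t \<longleftrightarrow> \<C> (arc_in D (0, cis t)) = \<C>' (arc_in D (0, cis t))" for t
  have agree_out: "agree t \<longleftrightarrow> \<C> (arc_out D (0, cis t)) = \<C>' (arc_out D (0, cis t))" for t
  proof (cases "cis t \<in> occs")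
    case True
    then show ?thesis
      using two_colouringsD[OF C(1)] two_colouringsD[OF C(2)]
      unfolding agree_def colour_neq_iff by (metis other_colour_involutive)
  next
    case False
    then show ?thesis
      by (simp add: agree_def arc_in_eq_arc_out)
  qed
  have "\<forall>\<^sub>F s in at t. agree t = agree s" for t
    unfolding eventually_at_split
  proof
    show "\<forall>\<^sub>F s in at_left t. agree t = agree s"
      using eventually_arc_in_at_left[of t] by eventually_elim (simp add: agree_def)
    show "\<forall>\<^sub>F s in at_right t. agree t = agree s"
      using eventually_arc_in_at_right[of t]
      by eventually_elim (simp add: agree_out[of t], simp add: agree_def)
  qed
  then have const: "agree s = agree t" for s t
    using connected_local_const[of UNIV s t agree] by auto
  \<comment> \<open>Values on arcs are reached through incoming arcs; off the arcs both functions
    are \<open>undefined\<close>.\<close>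
  have ext: "\<C>' = \<E>" if "\<E> \<in> two_colourings D"
    "\<And>t. \<C>' (arc_in D (0, cis t)) = \<E> (arc_in D (0, cis t))" for \<E>
    using that(2) arcs_imp_arc_in
    by (intro extensionalityI[OF two_colourings_extensional two_colourings_extensional] C that)
      metis
  show ?thesis
  proof (cases "agree 0")
    case True
    then show ?thesis
      using const[of 0] ext[OF C(1)] unfolding agree_def by metis
  next
    case False
    then have "\<not> agree t" for t
      using const by blast
    then show ?thesis
      by (intro disjI2 ext global_dual_in C)
        (simp add: agree_def global_dual_apply arc_in_arcs eq_commute flip: colour_neq_iff)
  qed
qed

text \<open>One angle with positive sign decides the colour of a whole arc, since the sign is
  constant on each arc when \<open>\<theta>\<close> chooses arguments for the occurrences.\<close>

definition sign_colouring :: "(complex \<Rightarrow> real) \<Rightarrow> colouring" where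
  "sign_colouring \<theta> = (\<lambda>(i, A) \<in> arcs D.
     if \<exists>t. cis t \<in> A \<and> sign_fun occs \<theta> t > 0 then Red else Green)"

context
  fixes \<theta> :: "complex \<Rightarrow> real"
  assumes \<theta>: "\<And>v. v \<in> occs \<Longrightarrow> cis (\<theta> v) = v"
begin

text \<open>On the connected set \<open>A\<close> the continuous function \<open>g\<close> has no
  zero, so a change of sign would contradict the intermediate value property.\<close>

lemma sign_colouring_component:
  assumes "A \<in> components (circle - occs)" "cis t \<in> A"
  shows "sign_colouring \<theta> (0, A) = Red \<longleftrightarrow> sign_fun occs \<theta> t > 0"
proof -
  obtain g :: "complex \<Rightarrow> real"
    where g: "continuous_on circle g" "\<And>t. g (cis t) = sign_fun occs \<theta> t"
    using sign_fun_descends[OF even_card_occs] \<theta> by metis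
  have A: "A \<subseteq> circle" "A \<inter> occs = {}" "connected A"
    using assms(1) in_components_subset in_components_connected by blast+
  have "connected (g ` A)"
    using A g(1) by (meson connected_continuous_image continuous_on_subset)
  have "0 \<notin> g ` A"
  proof
    assume "0 \<in> g ` A"
    then obtain u where u: "u \<in> A" "g u = 0" by auto
    with A obtain s where "u = cis s"
      by (metis circle_imp_cis subsetD)
    with u g(2) A(2) sign_fun_eq_0_iff[OF finite_occs \<theta>] show False by auto
  qed
  have "sign_fun occs \<theta> t > 0" if "cis s \<in> A" "sign_fun occs \<theta> s > 0" for s
  proof (rule ccontr)
    assume "\<not> sign_fun occs \<theta> t > 0"
    then have "0 \<in> {g (cis t)..g (cis s)}"
      using that g(2) by simp
    with that(1) assms(2) \<open>0 \<notin> g ` A\<close> connected_contains_Icc[OF \<open>connected (g ` A)\<close>]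
    show False by blast
  qed
  then show ?thesis
    using assms by (auto simp: sign_colouring_def arcs_eq)
qed

lemma eventually_sign_colouring_in:
  "\<forall>\<^sub>F s in at_left t. sign_colouring \<theta> (arc_in D (0, cis t)) = Red \<longleftrightarrow> sign_fun occs \<theta> s > 0"
proof -
  obtain A where A: "A \<in> components (circle - occs)" "\<forall>\<^sub>F s in at_left t. cis s \<in> A"
    "arc_in D (0, cis t) = (0, A)" by (rule arc_in_obtain)
  from A(2) show ?thesis
    by eventually_elim (use A sign_colouring_component in simp)
qed

lemma eventually_sign_colouring_out:
  "\<forall>\<^sub>F s in at_right t. sign_colouring \<theta> (arc_out D (0, cis t)) = Red \<longleftrightarrow> sign_fun occs \<theta> s > 0"
proof -
  obtain A where A: "A \<in> components (circle - occs)" "\<forall>\<^sub>F s in at_right t. cis s \<in> A"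
    "arc_out D (0, cis t) = (0, A)" by (rule arc_out_obtain)
  from A(2) show ?thesis
    by eventually_elim (use A sign_colouring_component in simp)
qed

lemma sign_colouring_in: "sign_colouring \<theta> \<in> two_colourings D"
proof (rule two_colouringsI)
  show "sign_colouring \<theta> \<in> extensional (arcs D)"
    by (simp add: sign_colouring_def)
  fix t assume "cis t \<in> occs"
  let ?i = "sign_colouring \<theta> (arc_in D (0, cis t))" and ?o = "sign_colouring \<theta> (arc_out D (0, cis t))"
  \<comment> \<open>Both one-sided limits are rewritten over \<open>at_right 0\<close>, so that they
    can be combined with \<open>sign_fun_changes\<close>.\<close>
  have "\<forall>\<^sub>F e in at_right 0. ?i = Red \<longleftrightarrow> sign_fun occs \<theta> (t - e) > 0"
    using eventually_sign_colouring_in[of t]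
    by (simp add: eventually_at_right_to_0[of _ "-t"] at_left_minus[of t] eventually_filtermap)
  moreover have "\<forall>\<^sub>F e in at_right 0. ?o = Red \<longleftrightarrow> sign_fun occs \<theta> (t + e) > 0"
    using eventually_sign_colouring_out[of t]
    by (simp add: eventually_at_right_to_0[of _ t] add.commute)
  moreover have "\<forall>\<^sub>F e in at_right 0. sign_fun occs \<theta> (t - e) * sign_fun occs \<theta> (t + e) < 0"
    using finite_occs \<theta> \<open>cis t \<in> occs\<close> by (rule sign_fun_changes)
  ultimately have "\<forall>\<^sub>F e in at_right (0::real). (?i = Red) \<noteq> (?o = Red)"
    by eventually_elim (auto simp: mult_less_0_iff)
  \<comment> \<open>The statement does not depend on \<open>e\<close>, and \<open>at_right 0\<close>
    is a nontrivial filter.\<close>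
  then show "?i \<noteq> ?o"
    by (auto simp: eventually_const)
qed

end

section \<open>Parities and writhes\<close>

text \<open>Any colouring is a sign colouring or its dual, and both give the same answer on equality
  of two colours. So a single sign colouring, with arguments measured from \<open>z\<close>, can be
  computed explicitly.\<close>

lemma colour_arc_in_eq_iff:
  assumes C: "\<C> \<in> two_colourings D" and c: "c \<in> classical D"
    and zw: "z \<noteq> w" "fibre D c = {(0, z), (0, w)}"
  shows "\<C> (arc_in D (0, z)) = \<C> (arc_in D (0, w)) \<longleftrightarrow> odd (card (occurrences_between D z w))"
proof -
  have occ: "z \<in> occs" "w \<in> occs"
    using fibre_imp_occs[OF c] zw by auto
  obtain a where z: "z = cis a"
    using occ(1) occs_subset circle_imp_cis by blast
  \<comment> \<open>The lift of the argument with values in the full turn starting at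
    \<open>a\<close>, so that the order of traversal from \<open>z\<close> becomes the order of
    reals.\<close>
  define \<theta> where "\<theta> v = a + Arg2pi (v / z)" for v
  have \<theta>: "cis (\<theta> v) = v" if "v \<in> occs" for v
  proof -
    have "norm (v / z) = 1"
      using that occs_subset z by (auto simp: norm_divide)
    then have "cis (Arg2pi (v / z)) = v / z"
      using Arg2pi_eq[of "v / z"] by (simp add: cis_conv_exp)
    then have "cis (\<theta> v) = cis a * (v / z)"
      by (simp add: \<theta>_def flip: cis_mult)
    then show ?thesis
      unfolding z by simp
  qed
  have range: "a \<le> \<theta> v" "\<theta> v < a + 2 * pi" for v
    by (auto simp: \<theta>_def Arg2pi_ge_0 Arg2pi_lt_2pi)
  define b where "b = \<theta> w"
  have w: "w = cis b" using \<theta> occ by (simp add: b_def)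
  have inj: "\<theta> v = s \<longleftrightarrow> v = cis s" if "v \<in> occs" "a \<le> s" "s < a + 2 * pi" for v s
    using that range[of v] \<theta>[of v] cis_eq_imp_eq[of "\<theta> v" s] by auto
  have \<theta>z: "\<theta> z = a"
    using inj[of z a] occ(1) z by simp
  have "a \<noteq> b"
    using z w zw(1) by blast
  then have b: "a < b" "b < a + 2 * pi"
    using range[of w] by (simp_all add: b_def)
  let ?S = "sign_colouring \<theta>"
  have S: "?S \<in> two_colourings D"
    using sign_colouring_in \<theta> by blast
  \<comment> \<open>Just before \<open>t\<close> the negative factors are those with
    \<open>t \<le> \<theta> v\<close>; a factor vanishing at \<open>t\<close> itself still counts as
    negative.\<close>
  have S_eq_Red: "?S (arc_in D (0, cis t)) = Red \<longleftrightarrow> even (card {v \<in> occs. t \<le> \<theta> v})"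
    if "a \<le> t" "t < a + 2 * pi" for t
  proof -
    \<comment> \<open>Takes \<open>s\<close> so close to \<open>t\<close> that no argument lies in
      \<open>[s, t)\<close> and all differences stay below a full turn, as
      \<open>sign_fun_sgn\<close> demands.\<close>
    have "\<forall>\<^sub>F s in at_left t. \<forall>v\<in>occs. \<theta> v - 2 * pi < s \<and> (\<theta> v < t \<longrightarrow> \<theta> v < s)"
    proof (intro eventually_ball_finite finite_occs ballI eventually_conj)
      fix v
      show "\<forall>\<^sub>F s in at_left t. \<theta> v - 2 * pi < s"
        using range(2)[of v] that(1) eventually_at_left_real[of "\<theta> v - 2 * pi" t]
        by (auto elim: eventually_mono)
      show "\<forall>\<^sub>F s in at_left t. \<theta> v < t \<longrightarrow> \<theta> v < s"
        using eventually_at_left_real[of "\<theta> v" t]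
        by (cases "\<theta> v < t") (auto elim: eventually_mono)
    qed
    moreover have "\<forall>\<^sub>F s in at_left t. s < t"
      using eventually_at_left_real[of "t - 1" t] by (auto elim: eventually_mono)
    moreover have "\<forall>\<^sub>F s in at_left t. ?S (arc_in D (0, cis t)) = Red \<longleftrightarrow> sign_fun occs \<theta> s > 0"
      using \<theta> by (rule eventually_sign_colouring_in)
    ultimately have "\<forall>\<^sub>F s in at_left t.
        ?S (arc_in D (0, cis t)) = Red \<longleftrightarrow> even (card {v \<in> occs. t \<le> \<theta> v})"
    proof eventually_elim
      case (elim s)
      have *: "\<bar>s - \<theta> v\<bar> < 2 * pi" "s \<noteq> \<theta> v" "s < \<theta> v \<longleftrightarrow> t \<le> \<theta> v" if "v \<in> occs" for v
        using elim that range[of v] \<open>t < a + 2 * pi\<close> by force+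
      have "{v \<in> occs. s < \<theta> v} = {v \<in> occs. t \<le> \<theta> v}"
        using *(3) by blast
      then have "sgn (sign_fun occs \<theta> s) = (-1) ^ card {v \<in> occs. t \<le> \<theta> v}"
        using sign_fun_sgn[OF finite_occs, of s \<theta>] * by simp
      then have "sign_fun occs \<theta> s > 0 \<longleftrightarrow> even (card {v \<in> occs. t \<le> \<theta> v})"
        by (simp add: minus_one_power_iff sgn_if split: if_splits)
      with elim show ?case by simp
    qed
    then show ?thesis by (simp add: eventually_const)
  qed
  have "{v \<in> occs. a \<le> \<theta> v} = occs"
    using range by auto
  then have "?S (arc_in D (0, z)) = Red"
    using S_eq_Red[of a] even_card_occs z by simp
  moreover have "?S (arc_in D (0, w)) = Red \<longleftrightarrow> odd (card (occurrences_between D z w))"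
  proof -
    let ?B = "{v \<in> occs. b \<le> \<theta> v}"
    have between: "occurrences_between D z w = {v \<in> occs. a < \<theta> v \<and> \<theta> v < b}" (is "?O = ?M")
    proof (intro equalityI subsetI)
      fix u assume "u \<in> ?O"
      then obtain s t where st: "u \<in> occs" "0 < s" "s < t" "t < 2 * pi" "u = cis (a + s)" "w = cis (a + t)"
        unfolding occurrences_between_def z cis_mult by blast
      then have "\<theta> u = a + s" "\<theta> w = a + t"
        using inj occ by auto
      with st show "u \<in> ?M" by (simp add: b_def)
    next
      fix u assume u: "u \<in> ?M"
      have "\<exists>s t. 0 < s \<and> s < t \<and> t < 2 * pi \<and> u = z * cis s \<and> w = z * cis t"
        using u b \<theta> w
        by (intro exI[of _ "\<theta> u - a"] exI[of _ "b - a"]) (simp add: z cis_mult)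
      with u show "u \<in> ?O"
        by (simp add: occurrences_between_def)
    qed
    \<comment> \<open>The occurrence \<open>w\<close> belongs to \<open>?B\<close>, whereas
      \<open>z\<close> is counted separately; this one extra element turns even into odd.\<close>
    have "occs = ?B \<union> insert z ?O"
      unfolding between using inj[of _ a] range b occ z \<theta>z by (auto simp: order_less_le)
    moreover have "?B \<inter> insert z ?O = {}" "z \<notin> ?O"
      unfolding between using b \<theta>z by auto
    moreover have "finite ?O" "finite ?B"
      using finite_occs by (auto simp: between)
    ultimately have "card occs = card ?B + Suc (card ?O)"
      by (metis card_Un_disjoint card_insert_disjoint finite_insert)
    then have "even (card ?B) \<longleftrightarrow> odd (card ?O)"
      using even_card_occs by (metis even_Suc even_add)
    with S_eq_Red[of b] b w show ?thesis by simp
  qed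
  ultimately have *: "?S (arc_in D (0, z)) = ?S (arc_in D (0, w)) \<longleftrightarrow>
      odd (card (occurrences_between D z w))"
    by metis
  have "arc_in D (0, z) \<in> arcs D" "arc_in D (0, w) \<in> arcs D"
    unfolding z w by (rule arc_in_arcs)+
  with two_colourings_unique[OF S C] * show ?thesis
    by (metis global_dual_apply other_colour_involutive)
qed

text \<open>\<open>gauss_odd\<close> asks for some ordering of the two occurrences. The colour
  criterion holds for every ordering, so both orderings give the same parity.\<close>

lemma colour_parity_eq_1_iff:
  assumes "\<C> \<in> two_colourings D" "c \<in> classical D"
  shows "colour_parity D \<C> c = 1 \<longleftrightarrow> gauss_odd D c"
proof -
  have "colour_parity D \<C> c = 1 \<longleftrightarrow> odd (card (occurrences_between D z w))"
    if zw: "z \<noteq> w" "fibre D c = {(0, z), (0, w)}" for z w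
    using zw(1) colour_arc_in_eq_iff[OF assms zw, symmetric]
    unfolding colour_parity_def zw(2) by auto
  then show ?thesis
    using fibre_classical[OF assms(2)] unfolding gauss_odd_def by metis
qed

lemma colouring_writhe_eq:
  assumes "\<C> \<in> two_colourings D"
  shows "colouring_writhe D \<C> = diagram_odd_writhe D"
  unfolding colouring_writhe_def diagram_odd_writhe_def
  using colour_parity_eq_1_iff[OF assms] by (intro sum.cong) auto

text \<open>The only colourings are \<open>\<C>\<close> and its dual, so a generating set is a
  singleton, and either choice yields the same writhe.\<close>

lemma generated_writhe_eq:
  assumes "generating_set D \<G>"
  shows "generated_writhe D \<G> = {#diagram_odd_writhe D#}"
proof -
  obtain \<C> where C: "\<C> \<in> two_colourings D"
    using assms by (auto simp: generating_set_def)
  have "\<G> \<subseteq> {\<C>, global_dual D \<C>}" "(\<C> \<in> \<G>) \<noteq> (global_dual D \<C> \<in> \<G>)"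
    using assms C two_colourings_unique[OF C] by (auto simp: generating_set_def)
  then have "\<G> = {\<C>} \<or> \<G> = {global_dual D \<C>}"
    by blast
  then show ?thesis
    using C global_dual_in[OF C] by (auto simp: generated_writhe_def colouring_writhe_eq)
qed

text \<open>Ensures that the choice made in \<open>diagram_two_colour_writhe\<close> really picks a
  generating set.\<close>

lemma ex_generating_set: "\<exists>\<G>. generating_set D \<G>"
proof -
  have "\<exists>t. v = cis t" if "v \<in> occs" for v
    using that occs_subset by (metis circle_imp_cis subsetD)
  then obtain \<theta> where "\<And>v. v \<in> occs \<Longrightarrow> cis (\<theta> v) = v"
    by metis
  then have S: "sign_colouring \<theta> \<in> two_colourings D" (is "?S \<in> _")
    by (rule sign_colouring_in)
  have "generating_set D {?S}"
    unfolding generating_set_def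
    using S two_colourings_unique[OF S] global_dual_neq global_dual_global_dual[OF S] by auto
  then show ?thesis ..
qed

end

section \<open>Diagrams of a virtual link\<close>

lemma virtual_move_num_comps: "virtual_move D D' \<Longrightarrow> num_comps D' = num_comps D"
  by (auto simp: virtual_move_def isotopic_def move1_def move2_def move3_def
      tangle_replacement_def)

lemma virtual_equivalence_num_comps:
  assumes "(D, D') \<in> virtual_equivalence"
  shows "num_comps D' = num_comps D"
proof -
  have "equivclp virtual_move D D'"
    using assms by (simp add: virtual_equivalence_def)
  then show ?thesis
    by (induction rule: equivclp_induct) (auto dest: virtual_move_num_comps)
qed

text \<open>\<open>virtual_knot\<close> constrains only the chosen diagram; invariance of
  \<open>num_comps\<close> under the moves extends this to every diagram in the class.\<close>

lemma virtual_knot_diagrams: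
  assumes "virtual_knot K"
  shows "diagram_of K \<in> K" "\<And>D. D \<in> K \<Longrightarrow> knot_diagram D"
proof -
  obtain E where E: "virtual_link_diagram E" "K = virtual_equivalence `` {E}"
    using assms by (auto simp: virtual_knot_def virtual_links_def quotient_def)
  then have "E \<in> K"
    by (simp add: virtual_equivalence_def)
  then show K: "diagram_of K \<in> K"
    unfolding diagram_of_def by (rule someI)
  have comps: "num_comps D = num_comps E" if "D \<in> K" for D
    using that E(2) virtual_equivalence_num_comps by blast
  fix D assume D: "D \<in> K"
  have "num_comps (diagram_of K) = 1"
    using assms by (simp add: virtual_knot_def link_comps_def)
  moreover have "virtual_link_diagram D"
    using D E(2) by (auto simp: virtual_equivalence_def)
  ultimately show "knot_diagram D"
    using comps[OF D] comps[OF K] by unfold_locales auto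
qed

theorem proposition3p4:
  fixes K :: "vdiagram set"
  assumes "virtual_knot K"
  shows "two_colour_writhe K = {#odd_writhe K#} \<and>
    (\<forall>D \<in> K. \<forall>\<G>. generating_set D \<G> \<longrightarrow> generated_writhe D \<G> = {#diagram_odd_writhe D#})"
proof
  have all: "generated_writhe D \<G> = {#diagram_odd_writhe D#}"
    if "D \<in> K" "generating_set D \<G>" for D \<G>
    using that virtual_knot_diagrams(2)[OF assms] knot_diagram.generated_writhe_eq by blast
  then show "\<forall>D \<in> K. \<forall>\<G>. generating_set D \<G> \<longrightarrow> generated_writhe D \<G> = {#diagram_odd_writhe D#}"
    by blast
  \<comment> \<open>The equation for the knot is the general one at the chosen diagram and the
    chosen generating set.\<close>
  let ?D = "diagram_of K"
  have "?D \<in> K" "generating_set ?D (SOME \<G>. generating_set ?D \<G>)"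
    using virtual_knot_diagrams[OF assms] knot_diagram.ex_generating_set by (blast intro: someI_ex)+
  then show "two_colour_writhe K = {#odd_writhe K#}"
    unfolding two_colour_writhe_def odd_writhe_def diagram_two_colour_writhe_def by (rule all)
qed

end
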